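(* There exist absolute positive constants $c$ and $c'$ such that for every $n\ge1$, every ellipsoid $E$ in $\mathbf{R}^n$, every orthonormal basis $\{e_1,\ldots,e_n\}$ of $\mathbf{R}^n$ and every positive integer $m\le c\sqrt n$ there is a subset $\sigma$ of $\{1,\ldots,n\}$ of cardinality $|\sigma|=m$ such that $$E\cap\mathbf{R}^{\sigma}\supseteq\frac{c'}{\sqrt m\,M_E}\,D_{\sigma}.$$
   Context: $\mathbf{R}^n$ carries an inner product $\langle\cdot,\cdot\rangle$ with Euclidean norm $|\cdot|$, unit ball $D_n$ and unit sphere $S^{n-1}$. An ellipsoid in $\mathbf{R}^n$ is a (non-degenerate, origin-centred) set $T^{-1}(D_n)$ with $T:\mathbf{R}^n\to\mathbf{R}^n$ a linear isomorphism. For a symmetric convex body $K$ with norm $\|\cdot\|_K$ having unit ball $K$, $M_K=\left(\int_{S^{n-1}}\|x\|_K^2\,d\mu(x)\right)^{1/2}$, where $\mu$ is the rotationally invariant probability measure on $S^{n-1}$. For $\sigma\subseteq\{1,\ldots,n\}$, $\mathbf{R}^{\sigma}=\{x\in\mathbf{R}^n:\langle x,e_j\rangle=0\text{ if }j\notin\sigma\}$ and $D_{\sigma}=D_n\cap\mathbf{R}^{\sigma}$. *)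

theory Defs
  imports "HOL-Probability.Probability_Measure" "Jordan_Normal_Form.Determinant"
begin

unbundle no inner_syntax

type_synonym rvec = "real Matrix.vec"

text \<open>The dimension \<open>n\<close> has to be quantified inside the formula, so \<open>\<^bold>R\<^sup>n\<close> is
  \<^term>\<open>carrier_vec n\<close> with the inner product \<^const>\<open>scalar_prod\<close>.\<close>

definition eucl_norm :: "rvec \<Rightarrow> real" where
  "eucl_norm x = sqrt (scalar_prod x x)"

definition unit_ball :: "nat \<Rightarrow> rvec set" where
  "unit_ball n = {x \<in> carrier_vec n. eucl_norm x \<le> 1}"

definition unit_sphere :: "nat \<Rightarrow> rvec set" where
  "unit_sphere n = {x \<in> carrier_vec n. eucl_norm x = 1}"

definition ellipsoid :: "nat \<Rightarrow> rvec set \<Rightarrow> bool" where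
  "ellipsoid n E \<longleftrightarrow>
     (\<exists>T \<in> carrier_mat n n. invertible_mat T \<and> E = {x \<in> carrier_vec n. T *\<^sub>v x \<in> unit_ball n})"

text \<open>The Borel \<open>\<sigma>\<close>-algebra of \<open>\<^bold>R\<^sup>n\<close>, generated by the coordinate functions.\<close>

definition vec_borel :: "nat \<Rightarrow> rvec measure" where
  "vec_borel n = vimage_algebra (carrier_vec n)
     (\<lambda>v. \<lambda>i\<in>{..<n}. vec_index v i) (\<Pi>\<^sub>M i\<in>{..<n}. (borel :: real measure))"

definition orthogonal_group :: "nat \<Rightarrow> real Matrix.mat set" where
  "orthogonal_group n = {Q \<in> carrier_mat n n. transpose_mat Q * Q = 1\<^sub>m n}"

text \<open>Invariance is under the full orthogonal group \<open>O(n)\<close>, which determines the measure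
  uniquely for every \<open>n \<ge> 1\<close> (for \<open>n = 1\<close>, invariance under \<open>SO(n)\<close> would be an empty
  condition). Existence is lemma \<open>rotation_invariant_prob_exists\<close> below.\<close>

definition rotation_invariant_prob :: "nat \<Rightarrow> rvec measure \<Rightarrow> bool" where
  "rotation_invariant_prob n \<mu> \<longleftrightarrow>
     prob_space \<mu> \<and> space \<mu> = unit_sphere n \<and>
     sets \<mu> = sets (restrict_space (vec_borel n) (unit_sphere n)) \<and>
     (\<forall>Q \<in> orthogonal_group n. distr \<mu> \<mu> (\<lambda>x. Q *\<^sub>v x) = \<mu>)"

text \<open>The norm with unit ball \<open>K\<close>, as the Minkowski functional of \<open>K\<close>.\<close>

definition norm_of_body :: "rvec set \<Rightarrow> rvec \<Rightarrow> real" where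
  "norm_of_body K x = Inf {t. 0 < t \<and> (1 / t) \<cdot>\<^sub>v x \<in> K}"

definition M_const :: "rvec measure \<Rightarrow> rvec set \<Rightarrow> real" where
  "M_const \<mu> K = sqrt (\<integral>x. (norm_of_body K x)\<^sup>2 \<partial>\<mu>)"

text \<open>\<open>n\<close> orthonormal vectors in \<open>\<^bold>R\<^sup>n\<close> automatically span.\<close>

definition orthonormal_basis :: "nat \<Rightarrow> (nat \<Rightarrow> rvec) \<Rightarrow> bool" where
  "orthonormal_basis n e \<longleftrightarrow>
     (\<forall>i\<in>{1..n}. e i \<in> carrier_vec n) \<and>
     (\<forall>i\<in>{1..n}. \<forall>j\<in>{1..n}. scalar_prod (e i) (e j) = (if i = j then 1 else 0))"

definition coord_subspace :: "nat \<Rightarrow> (nat \<Rightarrow> rvec) \<Rightarrow> nat set \<Rightarrow> rvec set" where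
  "coord_subspace n e \<sigma> = {x \<in> carrier_vec n. \<forall>j\<in>{1..n}. j \<notin> \<sigma> \<longrightarrow> scalar_prod x (e j) = 0}"

definition coord_ball :: "nat \<Rightarrow> (nat \<Rightarrow> rvec) \<Rightarrow> nat set \<Rightarrow> rvec set" where
  "coord_ball n e \<sigma> = unit_ball n \<inter> coord_subspace n e \<sigma>"

text \<open>Everything below serves only the existence proof of a rotation-invariant probability
  measure: normalised Lebesgue measure on a spherical shell, projected radially.\<close>

lemma space_vec_borel [simp]: "space (vec_borel n) = carrier_vec n"
  by (simp add: vec_borel_def)

lemma measurable_vec_index:
  assumes "i < n" shows "(\<lambda>v. vec_index v i) \<in> borel_measurable (vec_borel n)"
proof -
  have "(\<lambda>v. \<lambda>i\<in>{..<n}. vec_index v i) \<in> measurable (vec_borel n) (\<Pi>\<^sub>M i\<in>{..<n}. (borel :: real measure))"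
    unfolding vec_borel_def by (rule measurable_vimage_algebra1) (auto simp: space_PiM)
  from measurable_compose[OF this measurable_component_singleton[of i]]
  have "(\<lambda>v. (\<lambda>i\<in>{..<n}. vec_index v i) i) \<in> borel_measurable (vec_borel n)" using assms by simp
  then show ?thesis using assms by simp
qed

lemma measurable_vec_borelI:
  assumes "\<And>x. x \<in> space M \<Longrightarrow> f x \<in> carrier_vec n"
    and "\<And>i. i < n \<Longrightarrow> (\<lambda>x. vec_index (f x) i) \<in> borel_measurable M"
  shows "f \<in> measurable M (vec_borel n)"
  unfolding vec_borel_def
  by (rule measurable_vimage_algebra2) (use assms in \<open>auto intro!: measurable_restrict\<close>)

lemma measurable_vec_index_comp:
  assumes "f \<in> measurable M (vec_borel n)" "i < n"
  shows "(\<lambda>x. vec_index (f x) i) \<in> borel_measurable M"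
  using measurable_compose[OF assms(1) measurable_vec_index[OF assms(2)]] .

lemma measurable_vec_space:
  assumes "f \<in> measurable M (vec_borel n)" "x \<in> space M"
  shows "f x \<in> carrier_vec n"
  using measurable_space[OF assms] by simp

lemma measurable_scalar_prod:
  assumes "f \<in> measurable M (vec_borel n)" "g \<in> measurable M (vec_borel n)"
  shows "(\<lambda>x. scalar_prod (f x) (g x)) \<in> borel_measurable M"
proof -
  have "(\<lambda>x. \<Sum>i\<in>{0..<n}. vec_index (f x) i * vec_index (g x) i) \<in> borel_measurable M"
    using assms by (auto intro!: borel_measurable_sum borel_measurable_times measurable_vec_index_comp)
  moreover have "dim_vec (g x) = n" if "x \<in> space M" for x
    using measurable_vec_space[OF assms(2) that] by (rule carrier_vecD)
  ultimately show ?thesis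
    by (subst measurable_cong) (auto simp: scalar_prod_def)
qed

lemma measurable_mult_mat_vec:
  assumes "Q \<in> carrier_mat n n"
  shows "(\<lambda>x. Q *\<^sub>v x) \<in> measurable (vec_borel n) (vec_borel n)"
proof (rule measurable_vec_borelI)
  fix i assume i: "i < n"
  have "(\<lambda>x. scalar_prod (row Q i) x) \<in> borel_measurable (vec_borel n)"
    using assms i by (intro measurable_scalar_prod[where n=n] measurable_const) (auto simp: carrier_vecI)
  then show "(\<lambda>x. vec_index (Q *\<^sub>v x) i) \<in> borel_measurable (vec_borel n)"
    using assms i by simp
qed (use assms in auto)

lemma measurable_vec_add:
  assumes "f \<in> measurable M (vec_borel n)" "g \<in> measurable M (vec_borel n)"
  shows "(\<lambda>x. f x + g x) \<in> measurable M (vec_borel n)"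
proof (rule measurable_vec_borelI)
  fix i assume i: "i < n"
  have "(\<lambda>x. vec_index (f x) i + vec_index (g x) i) \<in> borel_measurable M"
    using assms i by (auto intro!: borel_measurable_add measurable_vec_index_comp)
  then show "(\<lambda>x. vec_index (f x + g x) i) \<in> borel_measurable M"
    by (rule measurable_cong[THEN iffD1, rotated])
      (use carrier_vecD[OF measurable_vec_space[OF assms(2)]] i in simp)
qed (rule add_carrier_vec[OF measurable_vec_space[OF assms(1)] measurable_vec_space[OF assms(2)]])

lemma measurable_vec_smult:
  assumes "f \<in> borel_measurable M" "g \<in> measurable M (vec_borel n)"
  shows "(\<lambda>x. f x \<cdot>\<^sub>v g x) \<in> measurable M (vec_borel n)"
proof (rule measurable_vec_borelI)
  fix i assume i: "i < n"
  have "(\<lambda>x. f x * vec_index (g x) i) \<in> borel_measurable M"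
    using assms i by (auto intro!: borel_measurable_times measurable_vec_index_comp)
  then show "(\<lambda>x. vec_index (f x \<cdot>\<^sub>v g x) i) \<in> borel_measurable M"
    by (rule measurable_cong[THEN iffD1, rotated])
      (use carrier_vecD[OF measurable_vec_space[OF assms(2)]] i in simp)
qed (simp add: measurable_vec_space[OF assms(2)])

lemma measurable_vec_of_fun:
  "Matrix.vec n \<in> measurable (\<Pi>\<^sub>M i\<in>{..<n}. (lborel :: real measure)) (vec_borel n)"
proof (rule measurable_vec_borelI)
  fix i assume i: "i < n"
  then have "(\<lambda>f. f i) \<in> measurable (\<Pi>\<^sub>M i\<in>{..<n}. (lborel :: real measure)) lborel"
    by (intro measurable_component_singleton) simp
  then show "(\<lambda>f. vec_index (Matrix.vec n f) i) \<in> borel_measurable (\<Pi>\<^sub>M i\<in>{..<n}. (lborel :: real measure))"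
    using i by simp
qed simp

definition vec_lborel :: "nat \<Rightarrow> rvec measure" where
  "vec_lborel n = distr (\<Pi>\<^sub>M i\<in>{..<n}. (lborel :: real measure)) (vec_borel n) (Matrix.vec n)"

lemma sets_vec_lborel [simp, measurable_cong]: "sets (vec_lborel n) = sets (vec_borel n)"
  by (simp add: vec_lborel_def)

lemma space_vec_lborel [simp]: "space (vec_lborel n) = carrier_vec n"
  by (simp add: vec_lborel_def)

definition vec_cube :: "nat \<Rightarrow> real \<Rightarrow> real \<Rightarrow> rvec set" where
  "vec_cube n a b = {x \<in> carrier_vec n. \<forall>i<n. vec_index x i \<in> {a..b}}"

lemma sets_vec_cube [measurable]: "vec_cube n a b \<in> sets (vec_borel n)"
proof -
  have "vec_cube n a b = {x \<in> space (vec_borel n). \<forall>i\<in>{..<n}. vec_index x i \<in> {a..b}}"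
    by (auto simp: vec_cube_def)
  also have "\<dots> \<in> sets (vec_borel n)"
  proof (rule sets.sets_Collect_finite_All)
    fix i assume "i \<in> {..<n}"
    then have "(\<lambda>v. vec_index v i) -` {a..b} \<inter> space (vec_borel n) \<in> sets (vec_borel n)"
      by (intro measurable_sets[OF measurable_vec_index]) auto
    then show "{x \<in> space (vec_borel n). vec_index x i \<in> {a..b}} \<in> sets (vec_borel n)"
      by (simp add: vimage_def Int_def conj_commute)
  qed simp
  finally show ?thesis .
qed

lemma emeasure_vec_cube:
  assumes "a \<le> b" shows "emeasure (vec_lborel n) (vec_cube n a b) = ennreal ((b - a) ^ n)"
proof -
  interpret product_sigma_finite "\<lambda>_::nat. lborel :: real measure" ..
  have "Matrix.vec n -` vec_cube n a b \<inter> space (\<Pi>\<^sub>M i\<in>{..<n}. (lborel :: real measure)) = (\<Pi>\<^sub>E i\<in>{..<n}. {a..b})"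
    by (auto simp: vec_cube_def space_PiM PiE_def Pi_def)
  then have "emeasure (vec_lborel n) (vec_cube n a b) = (\<Prod>i<n. emeasure lborel {a..b})"
    unfolding vec_lborel_def
    by (subst emeasure_distr) (auto simp: measurable_vec_of_fun sets_vec_cube emeasure_PiM)
  also have "\<dots> = ennreal ((b - a) ^ n)" using assms by (simp add: ennreal_power)
  finally show ?thesis .
qed

lemma sigma_finite_vec_lborel: "sigma_finite_measure (vec_lborel n)"
proof
  have "x \<in> (\<Union>k. vec_cube n (- real k) (real k))" if "x \<in> carrier_vec n" for x
  proof -
    obtain k where "(\<Sum>i<n. \<bar>vec_index x i\<bar>) \<le> real k" using real_arch_simple by blast
    moreover have "\<bar>vec_index x i\<bar> \<le> (\<Sum>i<n. \<bar>vec_index x i\<bar>)" if "i < n" for i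
      using that by (intro member_le_sum) auto
    ultimately have "\<bar>vec_index x i\<bar> \<le> real k" if "i < n" for i using that by force
    then have "x \<in> vec_cube n (- real k) (real k)" using that
      by (auto simp: vec_cube_def abs_le_iff) (smt (verit))
    then show ?thesis by blast
  qed
  then have "(\<Union>k. vec_cube n (- real k) (real k)) = carrier_vec n" by (auto simp: vec_cube_def)
  then show "\<exists>A. countable A \<and> A \<subseteq> sets (vec_lborel n) \<and> \<Union> A = space (vec_lborel n) \<and>
    (\<forall>a\<in>A. emeasure (vec_lborel n) a \<noteq> \<infinity>)"
    by (intro exI[of _ "range (\<lambda>k::nat. vec_cube n (- real k) (real k))"])
      (auto simp: sets_vec_cube emeasure_vec_cube)
qed

lemma vec_lborel_translate:
  assumes a: "a \<in> carrier_vec n"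
  shows "distr (vec_lborel n) (vec_borel n) (\<lambda>x. x + a) = vec_lborel n"
proof -
  interpret product_sigma_finite "\<lambda>_::nat. lborel :: real measure" ..
  let ?L = "\<Pi>\<^sub>M i\<in>{..<n}. (lborel :: real measure)"
  let ?t = "\<lambda>f. \<lambda>i\<in>{..<n}. vec_index a i + f i :: real"
  have mt: "?t \<in> measurable ?L ?L"
    proof (rule measurable_restrict)
    fix i assume "i \<in> {..<n}"
    then have "(\<lambda>f. f i) \<in> measurable ?L lborel" by (rule measurable_component_singleton)
    then have "(\<lambda>f. f i) \<in> borel_measurable ?L" by simp
    then show "(\<lambda>f. vec_index a i + f i) \<in> measurable ?L lborel" by simp
  qed
  have inv: "distr ?L ?L ?t = ?L"
  proof (rule PiM_eqI)
    fix A :: "nat \<Rightarrow> real set" assume A: "\<And>i. i \<in> {..<n} \<Longrightarrow> A i \<in> sets lborel"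
    let ?B = "\<lambda>i. (+) (vec_index a i) -` A i"
    have B: "?B i \<in> sets lborel" if "i < n" for i
      using measurable_sets[of "(+) (vec_index a i)" borel borel "A i"] A that by auto
    have "?t -` (Pi\<^sub>E {..<n} A) \<inter> space ?L = Pi\<^sub>E {..<n} ?B"
      by (auto simp: space_PiM PiE_def Pi_def)
    then have "emeasure (distr ?L ?L ?t) (Pi\<^sub>E {..<n} A) = emeasure ?L (Pi\<^sub>E {..<n} ?B)"
      using A by (subst emeasure_distr[OF mt]) (auto intro!: sets_PiM_I_finite)
    also have "\<dots> = (\<Prod>i<n. emeasure lborel (?B i))"
      using B by (intro emeasure_PiM) auto
    also have "\<dots> = (\<Prod>i<n. emeasure lborel (A i))"
    proof (rule prod.cong)
      fix i assume "i \<in> {..<n}"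
      then have "emeasure (distr lborel borel ((+) (vec_index a i))) (A i) = emeasure lborel (?B i)"
        using A by (subst emeasure_distr) auto
      then show "emeasure lborel (?B i) = emeasure lborel (A i)" by (simp add: lborel_distr_plus)
    qed simp
    finally show "emeasure (distr ?L ?L ?t) (Pi\<^sub>E {..<n} A) = (\<Prod>i<n. emeasure lborel (A i))" .
  qed auto
  have ma: "(\<lambda>x. x + a) \<in> measurable (vec_borel n) (vec_borel n)"
    using a by (intro measurable_vec_add) auto
  have "distr (vec_lborel n) (vec_borel n) (\<lambda>x. x + a) = distr ?L (vec_borel n) ((\<lambda>x. x + a) \<circ> Matrix.vec n)"
    unfolding vec_lborel_def by (rule distr_distr[OF ma measurable_vec_of_fun])
  also have "\<dots> = distr ?L (vec_borel n) (Matrix.vec n \<circ> ?t)"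
    by (rule distr_cong) (use a in \<open>auto\<close>)
  also have "\<dots> = distr (distr ?L ?L ?t) (vec_borel n) (Matrix.vec n)"
    by (rule distr_distr[OF measurable_vec_of_fun mt, symmetric])
  finally show ?thesis by (simp add: inv vec_lborel_def)
qed

text \<open>Fubini applied to the indicator of \<open>x + y \<in> A, y \<in> B\<close>.\<close>

lemma translation_invariant_unique:
  fixes \<mu> \<nu> :: "rvec measure"
  assumes sf: "sigma_finite_measure \<mu>" "sigma_finite_measure \<nu>"
    and S: "sets \<mu> = sets (vec_borel n)" "sets \<nu> = sets (vec_borel n)"
    and tm: "\<And>a. a \<in> carrier_vec n \<Longrightarrow> distr \<mu> (vec_borel n) (\<lambda>x. x + a) = \<mu>"
    and tn: "\<And>a. a \<in> carrier_vec n \<Longrightarrow> distr \<nu> (vec_borel n) (\<lambda>x. x + a) = \<nu>"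
    and A: "A \<in> sets (vec_borel n)" and B: "B \<in> sets (vec_borel n)"
    and sym: "\<And>x. x \<in> carrier_vec n \<Longrightarrow> - x \<in> B \<longleftrightarrow> x \<in> B"
  shows "emeasure \<nu> A * emeasure \<mu> B = emeasure \<mu> A * emeasure \<nu> B"
proof -
  interpret mu: sigma_finite_measure \<mu> by fact
  interpret nu: sigma_finite_measure \<nu> by fact
  interpret P: pair_sigma_finite \<mu> \<nu> ..
  note sp = sets_eq_imp_space_eq[OF S(1)] sets_eq_imp_space_eq[OF S(2)]
  note mc = measurable_cong_sets[OF S(1) refl] measurable_cong_sets[OF S(2) refl]
  have ma: "(\<lambda>x. x + a) \<in> measurable (vec_borel n) (vec_borel n)" if "a \<in> carrier_vec n" for a
    using that by (intro measurable_vec_add) auto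
  have Tm: "(\<integral>\<^sup>+x. f (x + a) \<partial>\<mu>) = (\<integral>\<^sup>+x. f x \<partial>\<mu>)"
    if "a \<in> carrier_vec n" "f \<in> borel_measurable (vec_borel n)" for a and f :: "rvec \<Rightarrow> ennreal"
    using nn_integral_distr[of "\<lambda>x. x + a" \<mu> "vec_borel n" f] ma[OF that(1)] that tm[OF that(1)]
    by (simp add: mc)
  have Tn: "(\<integral>\<^sup>+x. f (x + a) \<partial>\<nu>) = (\<integral>\<^sup>+x. f x \<partial>\<nu>)"
    if "a \<in> carrier_vec n" "f \<in> borel_measurable (vec_borel n)" for a and f :: "rvec \<Rightarrow> ennreal"
    using nn_integral_distr[of "\<lambda>x. x + a" \<nu> "vec_borel n" f] ma[OF that(1)] that tn[OF that(1)]
    by (simp add: mc)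
  let ?A = "indicator A :: rvec \<Rightarrow> ennreal" and ?B = "indicator B :: rvec \<Rightarrow> ennreal"
  have mA: "?A \<in> borel_measurable (vec_borel n)" and mB: "?B \<in> borel_measurable (vec_borel n)"
    using A B by auto
  have f1: "fst \<in> measurable (\<mu> \<Otimes>\<^sub>M \<nu>) (vec_borel n)"
    using measurable_fst[of \<mu> \<nu>] measurable_cong_sets[OF refl S(1), of "\<mu> \<Otimes>\<^sub>M \<nu>"] by simp
  have f2: "snd \<in> measurable (\<mu> \<Otimes>\<^sub>M \<nu>) (vec_borel n)"
    using measurable_snd[of \<mu> \<nu>] measurable_cong_sets[OF refl S(2), of "\<mu> \<Otimes>\<^sub>M \<nu>"] by simp
  have neg: "(\<lambda>x. (-1) \<cdot>\<^sub>v x + y) \<in> measurable (vec_borel n) (vec_borel n)" if "y \<in> carrier_vec n" for y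
    using that by (intro measurable_vec_add measurable_vec_smult) auto
  have "emeasure \<nu> A * emeasure \<mu> B = (\<integral>\<^sup>+y. (\<integral>\<^sup>+x. ?A x * ?B y \<partial>\<nu>) \<partial>\<mu>)"
    using A B S by (simp add: nn_integral_multc nn_integral_cmult)
  also have "\<dots> = (\<integral>\<^sup>+y. (\<integral>\<^sup>+x. ?A (x + y) * ?B y \<partial>\<nu>) \<partial>\<mu>)"
    by (rule nn_integral_cong, rule Tn[symmetric]) (use mA in \<open>auto simp: sp\<close>)
  also have "\<dots> = (\<integral>\<^sup>+x. (\<integral>\<^sup>+y. ?A (x + y) * ?B y \<partial>\<mu>) \<partial>\<nu>)"
  proof (rule P.Fubini'[symmetric])
    have "(\<lambda>p. ?A (snd p + fst p) * ?B (fst p)) \<in> borel_measurable (\<mu> \<Otimes>\<^sub>M \<nu>)"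
      by (intro borel_measurable_times_ennreal measurable_compose[OF measurable_vec_add[OF f2 f1] mA]
          measurable_compose[OF f1 mB])
    then show "(\<lambda>(y, x). ?A (x + y) * ?B y) \<in> borel_measurable (\<mu> \<Otimes>\<^sub>M \<nu>)"
      by (simp add: case_prod_beta)
  qed
  also have "\<dots> = (\<integral>\<^sup>+x. (\<integral>\<^sup>+y. ?A y * ?B ((-1) \<cdot>\<^sub>v x + y) \<partial>\<mu>) \<partial>\<nu>)"
  proof (rule nn_integral_cong)
    fix x assume "x \<in> space \<nu>" then have x: "x \<in> carrier_vec n" by (simp add: sp)
    have "(\<integral>\<^sup>+y. ?A y * ?B ((-1) \<cdot>\<^sub>v x + y) \<partial>\<mu>) = (\<integral>\<^sup>+y. ?A (y + x) * ?B ((-1) \<cdot>\<^sub>v x + (y + x)) \<partial>\<mu>)"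
      by (rule Tm[OF x, symmetric])
        (intro borel_measurable_times_ennreal mA measurable_compose[OF _ mB] measurable_vec_add measurable_const measurable_ident; use x in simp)
    also have "\<dots> = (\<integral>\<^sup>+y. ?A (x + y) * ?B y \<partial>\<mu>)"
    proof (rule nn_integral_cong)
      fix y assume "y \<in> space \<mu>" then have y: "y \<in> carrier_vec n" by (simp add: sp)
      have "y + x = x + y" "(-1) \<cdot>\<^sub>v x + (y + x) = y"
        using carrier_vecD[OF x] carrier_vecD[OF y] by (auto intro!: eq_vecI)
      then show "?A (y + x) * ?B ((-1) \<cdot>\<^sub>v x + (y + x)) = ?A (x + y) * ?B y" by simp
    qed
    finally show "(\<integral>\<^sup>+y. ?A (x + y) * ?B y \<partial>\<mu>) = (\<integral>\<^sup>+y. ?A y * ?B ((-1) \<cdot>\<^sub>v x + y) \<partial>\<mu>)" by simp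
  qed
  also have "\<dots> = (\<integral>\<^sup>+y. (\<integral>\<^sup>+x. ?A y * ?B ((-1) \<cdot>\<^sub>v x + y) \<partial>\<nu>) \<partial>\<mu>)"
  proof (rule P.Fubini')
    have "(\<lambda>p. ?A (fst p) * ?B ((-1) \<cdot>\<^sub>v snd p + fst p)) \<in> borel_measurable (\<mu> \<Otimes>\<^sub>M \<nu>)"
      by (intro borel_measurable_times_ennreal measurable_compose[OF f1 mA] measurable_const
          measurable_compose[OF measurable_vec_add[OF measurable_vec_smult[OF borel_measurable_const f2] f1] mB])
    then show "(\<lambda>(y, x). ?A y * ?B ((-1) \<cdot>\<^sub>v x + y)) \<in> borel_measurable (\<mu> \<Otimes>\<^sub>M \<nu>)"
      by (simp add: case_prod_beta)
  qed
  also have "\<dots> = (\<integral>\<^sup>+y. ?A y * emeasure \<nu> B \<partial>\<mu>)"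
  proof (rule nn_integral_cong)
    fix y assume "y \<in> space \<mu>" then have y: "y \<in> carrier_vec n" by (simp add: sp)
    have "(\<integral>\<^sup>+x. ?A y * ?B ((-1) \<cdot>\<^sub>v x + y) \<partial>\<nu>) = ?A y * (\<integral>\<^sup>+x. ?B ((-1) \<cdot>\<^sub>v x + y) \<partial>\<nu>)"
      using measurable_compose[OF neg[OF y] mB] by (intro nn_integral_cmult) (simp add: mc)
    also have "(\<integral>\<^sup>+x. ?B ((-1) \<cdot>\<^sub>v x + y) \<partial>\<nu>) = (\<integral>\<^sup>+x. ?B (x + (- y)) \<partial>\<nu>)"
    proof (rule nn_integral_cong)
      fix x assume "x \<in> space \<nu>" then have x: "x \<in> carrier_vec n" by (simp add: sp)
      have "(-1) \<cdot>\<^sub>v x + y = - (x + (- y))"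
        using carrier_vecD[OF x] carrier_vecD[OF y] by (auto intro!: eq_vecI)
      then show "?B ((-1) \<cdot>\<^sub>v x + y) = ?B (x + (- y))"
        using sym[of "x + (- y)"] x y by (simp add: indicator_def)
    qed
    also have "\<dots> = (\<integral>\<^sup>+x. ?B x \<partial>\<nu>)" using y mB by (intro Tn) auto
    also have "\<dots> = emeasure \<nu> B" using B S by simp
    finally show "(\<integral>\<^sup>+x. ?A y * ?B ((-1) \<cdot>\<^sub>v x + y) \<partial>\<nu>) = ?A y * emeasure \<nu> B" .
  qed
  also have "\<dots> = emeasure \<mu> A * emeasure \<nu> B" using A S by (simp add: nn_integral_multc)
  finally show ?thesis .
qed

lemma orthogonal_groupD:
  assumes "Q \<in> orthogonal_group n"
  shows "Q \<in> carrier_mat n n" "transpose_mat Q \<in> carrier_mat n n" "Q * transpose_mat Q = 1\<^sub>m n"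
    "transpose_mat Q * Q = 1\<^sub>m n"
  using assms mat_mult_left_right_inverse[of "transpose_mat Q" n Q]
  by (auto simp: orthogonal_group_def)

lemma orthogonal_scalar_prod:
  assumes Q: "Q \<in> orthogonal_group n" and x: "x \<in> carrier_vec n"
  shows "scalar_prod (Q *\<^sub>v x) (Q *\<^sub>v x) = scalar_prod x x"
proof -
  note q = orthogonal_groupD[OF Q]
  have "scalar_prod (Q *\<^sub>v x) (Q *\<^sub>v x) = scalar_prod (transpose_mat Q *\<^sub>v (Q *\<^sub>v x)) x"
    using q x by (intro transpose_vec_mult_scalar[symmetric]) auto
  also have "transpose_mat Q *\<^sub>v (Q *\<^sub>v x) = x"
    using q x assoc_mult_mat_vec[of "transpose_mat Q" n n Q n x] by simp
  finally show ?thesis .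
qed

definition vec_shell :: "nat \<Rightarrow> rvec set" where
  "vec_shell n = {x \<in> carrier_vec n. 1 \<le> scalar_prod x x \<and> scalar_prod x x \<le> 4 * real n}"

lemma sets_vec_shell: "vec_shell n \<in> sets (vec_borel n)"
proof -
  have [measurable]: "(\<lambda>x. scalar_prod x x) \<in> borel_measurable (vec_borel n)"
    by (intro measurable_scalar_prod[where n=n]) auto
  have "{x \<in> space (vec_borel n). 1 \<le> scalar_prod x x \<and> scalar_prod x x \<le> 4 * real n} \<in> sets (vec_borel n)"
    by measurable
  then show ?thesis by (simp add: vec_shell_def)
qed

lemma emeasure_vec_shell:
  assumes n: "n \<ge> 1"
  shows "emeasure (vec_lborel n) (vec_shell n) \<noteq> 0" "emeasure (vec_lborel n) (vec_shell n) \<noteq> \<infinity>"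
proof -
  have 1: "vec_cube n 1 2 \<subseteq> vec_shell n"
  proof
    fix x assume "x \<in> vec_cube n 1 2"
    then have x: "x \<in> carrier_vec n" "\<And>i. i < n \<Longrightarrow> 1 \<le> vec_index x i \<and> vec_index x i \<le> 2"
      by (auto simp: vec_cube_def)
    have b: "1 \<le> vec_index x i * vec_index x i \<and> vec_index x i * vec_index x i \<le> 4" if "i < n" for i
      using x(2)[OF that] mult_mono[of 1 "vec_index x i" 1 "vec_index x i"]
        mult_mono[of "vec_index x i" 2 "vec_index x i" 2] by auto
    have "(\<Sum>i\<in>{0..<n}. 1) \<le> scalar_prod x x" 
      unfolding scalar_prod_def carrier_vecD[OF x(1)] by (intro sum_mono) (use b in auto)
    moreover have "scalar_prod x x \<le> (\<Sum>i\<in>{0..<n}. 4)"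
      unfolding scalar_prod_def carrier_vecD[OF x(1)] by (intro sum_mono) (use b in auto)
    ultimately show "x \<in> vec_shell n" using n x(1) by (auto simp: vec_shell_def)
  qed
  have 2: "vec_shell n \<subseteq> vec_cube n (- (2 * real n)) (2 * real n)"
  proof
    fix x assume "x \<in> vec_shell n"
    then have x: "x \<in> carrier_vec n" "scalar_prod x x \<le> 4 * real n" by (auto simp: vec_shell_def)
    have "\<bar>vec_index x i\<bar> \<le> 2 * real n" if i: "i < n" for i
    proof -
      have "(vec_index x i)\<^sup>2 \<le> (\<Sum>j\<in>{0..<n}. (vec_index x j)\<^sup>2)" using i by (intro member_le_sum) auto
      also have "\<dots> = scalar_prod x x"
        unfolding scalar_prod_def carrier_vecD[OF x(1)] by (simp add: power2_eq_square)
      also have "\<dots> \<le> 4 * real n" by fact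
      also have "\<dots> \<le> (2 * real n)\<^sup>2" using n by (simp add: power2_eq_square)
      finally show ?thesis using power2_le_imp_le[of "\<bar>vec_index x i\<bar>" "2 * real n"] by simp
    qed
    then show "x \<in> vec_cube n (- (2 * real n)) (2 * real n)" using x(1)
      by (auto simp: vec_cube_def abs_le_iff) (smt (verit))
  qed
  have "emeasure (vec_lborel n) (vec_cube n 1 2) \<le> emeasure (vec_lborel n) (vec_shell n)"
    using 1 sets_vec_shell by (intro emeasure_mono) auto
  then show "emeasure (vec_lborel n) (vec_shell n) \<noteq> 0" by (auto simp: emeasure_vec_cube)
  have "emeasure (vec_lborel n) (vec_shell n) \<le> emeasure (vec_lborel n) (vec_cube n (- (2 * real n)) (2 * real n))"
    using 2 sets_vec_cube by (intro emeasure_mono) auto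
  then show "emeasure (vec_lborel n) (vec_shell n) \<noteq> \<infinity>" by (auto simp: emeasure_vec_cube top_unique)
qed

lemma vec_lborel_orthogonal:
  assumes Q: "Q \<in> orthogonal_group n" and n: "n \<ge> 1" and A: "A \<in> sets (vec_borel n)"
  shows "emeasure (vec_lborel n) {x \<in> carrier_vec n. Q *\<^sub>v x \<in> A} = emeasure (vec_lborel n) A"
proof -
  note q = orthogonal_groupD[OF Q]
  let ?\<mu> = "vec_lborel n" and ?\<nu> = "distr (vec_lborel n) (vec_borel n) (\<lambda>x. Q *\<^sub>v x)"
  have mQ: "(\<lambda>x. Q *\<^sub>v x) \<in> measurable ?\<mu> (vec_borel n)"
    using measurable_mult_mat_vec[OF q(1)] by (simp add: measurable_cong_sets[OF sets_vec_lborel refl])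
  have mQ': "(\<lambda>x. Q *\<^sub>v x) \<in> measurable (vec_borel n) (vec_borel n)"
    by (rule measurable_mult_mat_vec[OF q(1)])
  have mT: "(\<lambda>x. transpose_mat Q *\<^sub>v x) \<in> measurable (vec_borel n) (vec_borel n)"
    by (rule measurable_mult_mat_vec[OF q(2)])
  have QT: "Q *\<^sub>v (transpose_mat Q *\<^sub>v x) = x" if "x \<in> carrier_vec n" for x
    using q that assoc_mult_mat_vec[of Q n n "transpose_mat Q" n x] by simp
  have TQ: "transpose_mat Q *\<^sub>v (Q *\<^sub>v x) = x" if "x \<in> carrier_vec n" for x
    using q that assoc_mult_mat_vec[of "transpose_mat Q" n n Q n x] by simp
  have \<nu>: "emeasure ?\<nu> C = emeasure ?\<mu> {x \<in> carrier_vec n. Q *\<^sub>v x \<in> C}" if "C \<in> sets (vec_borel n)" for C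
    using that by (subst emeasure_distr[OF mQ]) (auto intro!: arg_cong[of _ _ "emeasure ?\<mu>"])
  have Bfix: "{x \<in> carrier_vec n. Q *\<^sub>v x \<in> vec_shell n} = vec_shell n"
    using orthogonal_scalar_prod[OF Q] q by (auto simp: vec_shell_def)
  interpret mu: sigma_finite_measure ?\<mu> by (rule sigma_finite_vec_lborel)
  have sf\<nu>: "sigma_finite_measure ?\<nu>"
  proof
    obtain F where F: "countable F" "F \<subseteq> sets ?\<mu>" "\<Union>F = space ?\<mu>" "\<forall>a\<in>F. emeasure ?\<mu> a \<noteq> \<infinity>"
      using mu.sigma_finite_countable by blast
    let ?g = "\<lambda>C. {x \<in> carrier_vec n. transpose_mat Q *\<^sub>v x \<in> C}"
    have g: "?g C \<in> sets (vec_borel n)" if "C \<in> F" for C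
      using measurable_sets[OF mT, of C] that F(2) by (auto simp: vimage_def Int_def conj_commute)
    have "{x \<in> carrier_vec n. Q *\<^sub>v x \<in> ?g C} = C" if "C \<in> F" for C
    proof -
      have "C \<in> sets (vec_borel n)" using that F(2) by auto
      then have "C \<subseteq> carrier_vec n" using sets.sets_into_space[of C "vec_borel n"] by simp
      then show ?thesis using q TQ by (auto simp: subset_iff)
    qed
    then have "emeasure ?\<nu> (?g C) \<noteq> \<infinity>" if "C \<in> F" for C
      using \<nu>[OF g[OF that]] F(4) that by simp
    moreover have "\<Union> (?g ` F) = carrier_vec n" using F(3) q by auto
    ultimately show "\<exists>A. countable A \<and> A \<subseteq> sets ?\<nu> \<and> \<Union> A = space ?\<nu> \<and> (\<forall>a\<in>A. emeasure ?\<nu> a \<noteq> \<infinity>)"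
      using F(1) g by (intro exI[of _ "?g ` F"]) auto
  qed
  have tn: "distr ?\<nu> (vec_borel n) (\<lambda>x. x + a) = ?\<nu>" if a: "a \<in> carrier_vec n" for a
  proof -
    let ?b = "transpose_mat Q *\<^sub>v a"
    have b: "?b \<in> carrier_vec n" using q a by auto
    have m: "(\<lambda>x. x + c) \<in> measurable (vec_borel n) (vec_borel n)" if "c \<in> carrier_vec n" for c
      using that by (intro measurable_vec_add) auto
    have m': "(\<lambda>x. x + ?b) \<in> measurable ?\<mu> (vec_borel n)"
      using m[OF b] by (simp add: measurable_cong_sets[OF sets_vec_lborel refl])
    have "distr ?\<nu> (vec_borel n) (\<lambda>x. x + a) = distr ?\<mu> (vec_borel n) ((\<lambda>x. x + a) \<circ> (\<lambda>x. Q *\<^sub>v x))"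
      by (rule distr_distr[OF m[OF a] mQ])
    also have "\<dots> = distr ?\<mu> (vec_borel n) ((\<lambda>x. Q *\<^sub>v x) \<circ> (\<lambda>x. x + ?b))"
      by (rule distr_cong) (use q a b in \<open>auto simp: mult_add_distrib_mat_vec[OF q(1)] QT\<close>)
    also have "\<dots> = distr (distr ?\<mu> (vec_borel n) (\<lambda>x. x + ?b)) (vec_borel n) (\<lambda>x. Q *\<^sub>v x)"
      by (rule distr_distr[OF mQ' m', symmetric])
    finally show ?thesis by (simp add: vec_lborel_translate[OF b])
  qed
  have "emeasure ?\<nu> A * emeasure ?\<mu> (vec_shell n) = emeasure ?\<mu> A * emeasure ?\<nu> (vec_shell n)"
    by (rule translation_invariant_unique[OF sigma_finite_vec_lborel sf\<nu> _ _ vec_lborel_translate tn A sets_vec_shell])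
      (auto simp: vec_shell_def)
  also have "emeasure ?\<nu> (vec_shell n) = emeasure ?\<mu> (vec_shell n)"
    using \<nu>[OF sets_vec_shell] Bfix by simp
  finally have "emeasure ?\<nu> A = emeasure ?\<mu> A"
    using emeasure_vec_shell[OF n] by (metis mult_divide_eq_ennreal infinity_ennreal_def)
  then show ?thesis using \<nu>[OF A] by simp
qed

lemma rotation_invariant_prob_exists:
  assumes n: "n \<ge> 1"
  shows "\<exists>\<mu>. rotation_invariant_prob n \<mu>"
proof -
  let ?L = "vec_lborel n" and ?R = "vec_shell n"
  define U where "U = uniform_measure ?L ?R"
  let ?S = "restrict_space (vec_borel n) (unit_sphere n)"
  define s :: "rvec \<Rightarrow> rvec" where
    "s x = (if x \<in> ?R then (1 / eucl_norm x) \<cdot>\<^sub>v x else unit_vec n 0)" for x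
  define \<mu> where "\<mu> = distr U ?S s"
  note R = emeasure_vec_shell[OF n] sets_vec_shell[of n]
  have setsU: "sets U = sets (vec_borel n)" by (simp add: U_def)
  have spU: "space U = carrier_vec n" using sets_eq_imp_space_eq[OF setsU] by simp
  have pU: "prob_space U" unfolding U_def using R by (intro prob_space_uniform_measure) auto
  have spS: "space ?S = unit_sphere n" by (auto simp: space_restrict_space unit_sphere_def)
  have norm_s: "eucl_norm (c \<cdot>\<^sub>v x) = \<bar>c\<bar> * eucl_norm x" if "x \<in> carrier_vec n" for c x
    using that by (simp add: eucl_norm_def real_sqrt_mult mult.assoc[symmetric])
  have sS: "s x \<in> unit_sphere n" for x
  proof (cases "x \<in> ?R")
    case True
    then have "x \<in> carrier_vec n" "eucl_norm x \<ge> 1" by (auto simp: vec_shell_def eucl_norm_def)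
    then show ?thesis using True by (auto simp: s_def unit_sphere_def norm_s)
  next
    case False
    then show ?thesis using n by (auto simp: s_def unit_sphere_def eucl_norm_def)
  qed
  have ms: "s \<in> measurable (vec_borel n) ?S"
  proof (rule measurable_restrict_space2)
    have "(\<lambda>x. scalar_prod x x) \<in> borel_measurable (vec_borel n)" by (intro measurable_scalar_prod[where n=n]) auto
    then have "eucl_norm \<in> borel_measurable (vec_borel n)" unfolding eucl_norm_def by measurable
    then have "(\<lambda>x. (1 / eucl_norm x) \<cdot>\<^sub>v x) \<in> measurable (vec_borel n) (vec_borel n)"
      by (intro measurable_vec_smult) auto
    then show "s \<in> measurable (vec_borel n) (vec_borel n)"
      unfolding s_def using R(3) sets.Int_space_eq2[OF R(3)] by (intro measurable_If_set) auto
  qed (use sS in auto)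
  then have msU: "s \<in> measurable U ?S" by (simp add: measurable_cong_sets[OF setsU refl])
  have sets\<mu>: "sets \<mu> = sets ?S" by (simp add: \<mu>_def)
  have sp\<mu>: "space \<mu> = unit_sphere n" by (simp add: \<mu>_def spS)
  have em: "emeasure \<mu> A = emeasure ?L {x \<in> ?R. s x \<in> A} / emeasure ?L ?R" if "A \<in> sets ?S" for A
  proof -
    have "s -` A \<inter> space U \<in> sets (vec_borel n)" using measurable_sets[OF msU that] setsU by simp
    then have "emeasure \<mu> A = emeasure ?L (?R \<inter> (s -` A \<inter> space U)) / emeasure ?L ?R"
      using that R(3) unfolding \<mu>_def emeasure_distr[OF msU that]
      by (subst U_def) (simp add: emeasure_uniform_measure)
    also have "?R \<inter> (s -` A \<inter> space U) = {x \<in> ?R. s x \<in> A}" by (auto simp: spU vec_shell_def)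
    finally show ?thesis .
  qed
  have inv: "distr \<mu> \<mu> (\<lambda>x. Q *\<^sub>v x) = \<mu>" if Q: "Q \<in> orthogonal_group n" for Q
  proof (rule measure_eqI)
    note q = orthogonal_groupD[OF Q]
    have mQ: "(\<lambda>x. Q *\<^sub>v x) \<in> measurable ?S ?S"
      by (rule measurable_restrict_space3[OF measurable_mult_mat_vec[OF q(1)]])
        (use q orthogonal_scalar_prod[OF Q] in \<open>auto simp: unit_sphere_def eucl_norm_def\<close>)
    then have mQ\<mu>: "(\<lambda>x. Q *\<^sub>v x) \<in> measurable \<mu> \<mu>" by (simp add: measurable_cong_sets[OF sets\<mu> sets\<mu>])
    fix A assume "A \<in> sets (distr \<mu> \<mu> (\<lambda>x. Q *\<^sub>v x))"
    then have A: "A \<in> sets ?S" by (simp add: sets\<mu>)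
    let ?A' = "(\<lambda>x. Q *\<^sub>v x) -` A \<inter> unit_sphere n"
    have A': "?A' \<in> sets ?S" using measurable_sets[OF mQ A] spS by simp
    have R': "Q *\<^sub>v x \<in> ?R \<longleftrightarrow> x \<in> ?R" if "x \<in> carrier_vec n" for x
      using that q orthogonal_scalar_prod[OF Q] by (auto simp: vec_shell_def)
    have sQ: "s (Q *\<^sub>v x) = Q *\<^sub>v s x" if "x \<in> ?R" for x
      using that q R' orthogonal_scalar_prod[OF Q, of x]
      by (auto simp: s_def vec_shell_def eucl_norm_def mult_mat_vec[OF q(1)])
    have eq: "{x \<in> ?R. s x \<in> ?A'} = {x \<in> carrier_vec n. Q *\<^sub>v x \<in> {x \<in> ?R. s x \<in> A}}"
    proof (rule Set.set_eqI)
      fix x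
      have "x \<in> carrier_vec n" if "x \<in> ?R" using that by (simp add: vec_shell_def)
      then show "x \<in> {x \<in> ?R. s x \<in> ?A'} \<longleftrightarrow> x \<in> {x \<in> carrier_vec n. Q *\<^sub>v x \<in> {x \<in> ?R. s x \<in> A}}"
        using R'[of x] sS[of x] sQ[of x] by auto
    qed
    have "{x \<in> ?R. s x \<in> A} = (s -` A \<inter> space (vec_borel n)) \<inter> ?R" by (auto simp: vec_shell_def)
    also have "\<dots> \<in> sets (vec_borel n)" using measurable_sets[OF ms A] R(3) by (rule sets.Int)
    finally have "emeasure ?L {x \<in> ?R. s x \<in> ?A'} = emeasure ?L {x \<in> ?R. s x \<in> A}"
      unfolding eq by (rule vec_lborel_orthogonal[OF Q n])
    then show "emeasure (distr \<mu> \<mu> (\<lambda>x. Q *\<^sub>v x)) A = emeasure \<mu> A"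
      using em[OF A] em[OF A'] A by (simp add: emeasure_distr[OF mQ\<mu>] sets\<mu> sp\<mu>)
  qed simp
  have "prob_space \<mu>" unfolding \<mu>_def by (rule prob_space.prob_space_distr[OF pU msU])
  then show ?thesis using sets\<mu> sp\<mu> inv by (auto simp: rotation_invariant_prob_def)
qed

end

theory Submission
  imports Defs
begin

unbundle no vec_syntax

text \<open>If \<open>E = T\<^sup>-\<^sup>1(D\<^sub>n)\<close>, then \<open>\<parallel>x\<parallel>\<^sub>E = |T x|\<close>. The coordinates of a uniform point of the sphere
  are uncorrelated with second moment \<open>1/n\<close>, so \<open>n M\<^sub>E\<^sup>2 = \<Sum>\<^sub>k |T e\<^sub>k|\<^sup>2\<close> for every orthonormal
  basis. Let \<open>\<sigma>\<close> consist of the indices of the \<open>m\<close> smallest terms; they sum to at most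
  \<open>m M\<^sub>E\<^sup>2\<close>, and by Cauchy-Schwarz \<open>|T x|\<^sup>2 \<le> m M\<^sub>E\<^sup>2 |x|\<^sup>2\<close> on \<open>\<real>\<^sup>\<sigma>\<close>. This works for all
  \<open>m \<le> n\<close>, with \<open>c = c' = 1\<close>.\<close>

section \<open>Euclidean norms and the norm whose unit ball is an ellipsoid\<close>

lemma scalar_prod_self_eq_sum:
  fixes x :: rvec
  assumes "x \<in> carrier_vec n"
  shows "scalar_prod x x = (\<Sum>i<n. (x $ i)\<^sup>2)"
  unfolding scalar_prod_def carrier_vecD[OF assms]
  by (simp add: power2_eq_square lessThan_atLeast0)

lemma eucl_norm_sq: "(eucl_norm x)\<^sup>2 = scalar_prod x x"
  by (simp add: eucl_norm_def scalar_prod_def sum_nonneg)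

lemma eucl_norm_nonneg: "0 \<le> eucl_norm x"
  by (simp add: eucl_norm_def scalar_prod_def sum_nonneg)

lemma eucl_norm_smult:
  "eucl_norm (c \<cdot>\<^sub>v x) = \<bar>c\<bar> * eucl_norm x"
proof -
  have "scalar_prod (c \<cdot>\<^sub>v x) (c \<cdot>\<^sub>v x) = c\<^sup>2 * scalar_prod x x"
    by (simp add: scalar_prod_def sum_distrib_left power2_eq_square ac_simps)
  then show ?thesis by (simp add: eucl_norm_def real_sqrt_mult)
qed

lemma mult_mat_vec_index_sum:
  fixes B :: "real Matrix.mat"
  assumes "B \<in> carrier_mat r n" "x \<in> carrier_vec n" "a < r"
  shows "(B *\<^sub>v x) $ a = (\<Sum>k<n. B $$ (a, k) * x $ k)"
  using assms by (auto simp: scalar_prod_def lessThan_atLeast0 intro!: sum.cong)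

text \<open>For t > 0 the point x / t lies in the ellipsoid exactly when |Tx| <= t, so the Minkowski
  functional is the infimum of the positive t that are at least |Tx|.\<close>

lemma norm_of_body_ellipsoid:
  assumes "T \<in> carrier_mat n n" "x \<in> carrier_vec n"
  shows "norm_of_body {x \<in> carrier_vec n. T *\<^sub>v x \<in> unit_ball n} x = eucl_norm (T *\<^sub>v x)"
proof -
  let ?N = "eucl_norm (T *\<^sub>v x)"
  have Tx: "T *\<^sub>v x \<in> carrier_vec n" using assms by simp
  have "(1 / t) \<cdot>\<^sub>v x \<in> {x \<in> carrier_vec n. T *\<^sub>v x \<in> unit_ball n} \<longleftrightarrow> ?N \<le> t" if "0 < t" for t
    using assms Tx that
    by (auto simp: unit_ball_def mult_mat_vec[OF assms] eucl_norm_smult divide_simps)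
  then have eq: "{t. 0 < t \<and> (1 / t) \<cdot>\<^sub>v x \<in> {x \<in> carrier_vec n. T *\<^sub>v x \<in> unit_ball n}}
    = {t. 0 < t \<and> ?N \<le> t}" by auto
  have "Inf {t. 0 < t \<and> ?N \<le> t} = ?N"
  proof (rule antisym)
    show "Inf {t. 0 < t \<and> ?N \<le> t} \<le> ?N"
    proof (rule field_le_epsilon)
      fix d :: real assume "d > 0"
      then show "Inf {t. 0 < t \<and> ?N \<le> t} \<le> ?N + d"
        using eucl_norm_nonneg[of "T *\<^sub>v x"] by (intro cInf_lower) (auto intro!: bdd_belowI)
    qed
    have "?N + 1 \<in> {t. 0 < t \<and> ?N \<le> t}" using eucl_norm_nonneg[of "T *\<^sub>v x"] by simp
    then show "?N \<le> Inf {t. 0 < t \<and> ?N \<le> t}" by (intro cInf_greatest) auto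
  qed
  then show ?thesis unfolding norm_of_body_def eq .
qed

section \<open>Signed permutation matrices, the symmetries that determine the second moments\<close>

definition signed_perm_mat :: "nat \<Rightarrow> (nat \<Rightarrow> nat) \<Rightarrow> (nat \<Rightarrow> real) \<Rightarrow> real Matrix.mat" where
  "signed_perm_mat n p s = Matrix.mat n n (\<lambda>(a, b). if b = p a then s a else 0)"

lemma signed_perm_mat_carrier: "signed_perm_mat n p s \<in> carrier_mat n n"
  by (simp add: signed_perm_mat_def)

lemma signed_perm_mat_mult_vec:
  assumes "x \<in> carrier_vec n" "a < n" "p a < n"
  shows "(signed_perm_mat n p s *\<^sub>v x) $ a = s a * x $ p a"
proof -
  have "(signed_perm_mat n p s *\<^sub>v x) $ a = (\<Sum>k<n. signed_perm_mat n p s $$ (a, k) * x $ k)"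
    by (rule mult_mat_vec_index_sum[OF signed_perm_mat_carrier assms(1,2)])
  also have "\<dots> = (\<Sum>k<n. if k = p a then s a * x $ k else 0)"
    using assms by (intro sum.cong) (auto simp: signed_perm_mat_def)
  also have "\<dots> = s a * x $ p a" using assms by simp
  finally show ?thesis .
qed

text \<open>Row \<open>a\<close> has its only nonzero entry in column \<open>p a\<close>, so it
  contributes to the inner product of columns \<open>b\<close> and \<open>c\<close> only if
  \<open>p a = b = c\<close>. Reindexing along the bijection \<open>p\<close> leaves one such row if
  \<open>b = c\<close> and none otherwise.\<close>

lemma signed_perm_mat_orthogonal:
  assumes p: "bij_betw p {..<n} {..<n}" and s: "\<And>a. a < n \<Longrightarrow> (s a)\<^sup>2 = 1"
  shows "signed_perm_mat n p s \<in> orthogonal_group n"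
proof -
  let ?Q = "signed_perm_mat n p s"
  have "transpose_mat ?Q * ?Q = 1\<^sub>m n"
  proof (rule eq_matI)
    fix b c assume "b < dim_row (1\<^sub>m n :: real Matrix.mat)" "c < dim_col (1\<^sub>m n :: real Matrix.mat)"
    then have b: "b < n" and c: "c < n" by auto
    have "(transpose_mat ?Q * ?Q) $$ (b, c) = (\<Sum>a<n. ?Q $$ (a, b) * ?Q $$ (a, c))"
      using b c signed_perm_mat_carrier[of n p s]
      by (auto simp: scalar_prod_def lessThan_atLeast0 intro!: sum.cong)
    also have "\<dots> = (\<Sum>a<n. if p a = b \<and> p a = c then 1 else 0)"
      using b c s by (intro sum.cong) (auto simp: signed_perm_mat_def power2_eq_square)
    also have "\<dots> = (\<Sum>a<n. if a = b \<and> a = c then 1 else 0)"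
      by (rule sum.reindex_bij_betw[OF p, of "\<lambda>a. if a = b \<and> a = c then 1 else 0"])
    also have "\<dots> = 1\<^sub>m n $$ (b, c)" using b c by (cases "b = c") (auto intro!: sum.neutral)
    finally show "(transpose_mat ?Q * ?Q) $$ (b, c) = 1\<^sub>m n $$ (b, c)" .
  qed (auto simp: signed_perm_mat_def)
  then show ?thesis by (simp add: orthogonal_group_def signed_perm_mat_carrier)
qed

section \<open>Second moments under a rotation-invariant probability on the sphere\<close>

context
  fixes n :: nat and \<mu> :: "rvec measure"
  assumes rot: "rotation_invariant_prob n \<mu>"
begin

lemma rot_space: "space \<mu> = unit_sphere n"
  and rot_prob: "prob_space \<mu>"
  using rot by (auto simp: rotation_invariant_prob_def)

lemma measurable_rot:
  assumes "f \<in> measurable (vec_borel n) N"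
  shows "f \<in> measurable \<mu> N"
proof -
  have "sets \<mu> = sets (restrict_space (vec_borel n) (unit_sphere n))"
    using rot by (simp add: rotation_invariant_prob_def)
  from measurable_cong_sets[OF this refl] show ?thesis
    using measurable_restrict_space1[OF assms] by blast
qed

text \<open>Invariance in the form of a change of variables, through which every symmetry enters the
  computations below.\<close>

lemma integral_orthogonal:
  fixes f :: "rvec \<Rightarrow> real"
  assumes Q: "Q \<in> orthogonal_group n" and f: "f \<in> borel_measurable (vec_borel n)"
  shows "(\<integral>x. f (Q *\<^sub>v x) \<partial>\<mu>) = (\<integral>x. f x \<partial>\<mu>)"
proof -
  note q = orthogonal_groupD[OF Q]
  have s: "sets \<mu> = sets (restrict_space (vec_borel n) (unit_sphere n))"
    using rot by (simp add: rotation_invariant_prob_def)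
  have "(\<lambda>x. Q *\<^sub>v x) \<in> measurable (restrict_space (vec_borel n) (unit_sphere n))
      (restrict_space (vec_borel n) (unit_sphere n))"
    by (rule measurable_restrict_space3[OF measurable_mult_mat_vec[OF q(1)]])
      (use q orthogonal_scalar_prod[OF Q] in \<open>auto simp: unit_sphere_def eucl_norm_def\<close>)
  then have m: "(\<lambda>x. Q *\<^sub>v x) \<in> measurable \<mu> \<mu>" by (simp add: measurable_cong_sets[OF s s])
  have "distr \<mu> \<mu> (\<lambda>x. Q *\<^sub>v x) = \<mu>" using rot Q by (simp add: rotation_invariant_prob_def)
  then show ?thesis using integral_distr[OF m measurable_rot[OF f]] by simp
qed

text \<open>Coordinates are bounded by 1 on the sphere and the total mass is finite. This justifies
  exchanging integrals with finite sums.\<close>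

lemma integrable_coord_mult:
  assumes j: "j < n" and k: "k < n"
  shows "integrable \<mu> (\<lambda>x. x $ j * x $ k)"
proof -
  interpret prob_space \<mu> by (rule rot_prob)
  have le: "\<bar>x $ i\<bar> \<le> 1" if x: "x \<in> unit_sphere n" and i: "i < n" for x :: rvec and i
  proof -
    have xc: "x \<in> carrier_vec n" and "(eucl_norm x)\<^sup>2 = 1" using x by (auto simp: unit_sphere_def)
    then have "(\<Sum>i<n. (x $ i)\<^sup>2) = 1" by (simp add: eucl_norm_sq scalar_prod_self_eq_sum)
    moreover have "(x $ i)\<^sup>2 \<le> (\<Sum>i<n. (x $ i)\<^sup>2)" using i by (intro member_le_sum) auto
    ultimately show ?thesis by (simp add: abs_square_le_1)
  qed
  have "norm (x $ j * x $ k) \<le> 1" if "x \<in> space \<mu>" for x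
    using le[of x j] le[of x k] that j k
    by (simp add: rot_space abs_mult mult_le_one)
  moreover have "(\<lambda>x. x $ j * x $ k) \<in> borel_measurable \<mu>"
    using j k by (intro measurable_rot borel_measurable_times measurable_vec_index)
  ultimately show ?thesis by (intro integrable_const_bound[where B = 1]) auto
qed

text \<open>For distinct indices, flipping the sign of coordinate \<open>j\<close> negates the
  integrand, so the integral equals its own negative. For equal indices, transposing two coordinates
  shows that all n second moments agree, and they add up to the integral of |x|^2 = 1.\<close>

lemma integral_coord_mult:
  assumes j: "j < n" and k: "k < n"
  shows "(\<integral>x. x $ j * x $ k \<partial>\<mu>) = (if j = k then 1 / real n else 0)"
proof (cases "j = k")
  case False
  let ?s = "\<lambda>a. if a = j then - 1 else 1 :: real"
  let ?Q = "signed_perm_mat n id ?s"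
  have m: "(\<lambda>x. x $ j * x $ k) \<in> borel_measurable (vec_borel n)"
    using j k by (intro borel_measurable_times measurable_vec_index)
  have "(\<integral>x. x $ j * x $ k \<partial>\<mu>) = (\<integral>x. (?Q *\<^sub>v x) $ j * (?Q *\<^sub>v x) $ k \<partial>\<mu>)"
    by (rule integral_orthogonal[OF _ m, symmetric], rule signed_perm_mat_orthogonal) auto
  also have "\<dots> = (\<integral>x. - (x $ j * x $ k) \<partial>\<mu>)"
    using False j k
    by (intro Bochner_Integration.integral_cong)
      (auto simp: rot_space unit_sphere_def signed_perm_mat_mult_vec)
  finally show ?thesis using False by simp
next
  case True
  have eq: "(\<integral>x. x $ i * x $ i \<partial>\<mu>) = (\<integral>x. x $ j * x $ j \<partial>\<mu>)" if i: "i < n" for i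
  proof -
    let ?p = "Transposition.transpose i j"
    let ?Q = "signed_perm_mat n ?p (\<lambda>_. 1)"
    have m: "(\<lambda>x. x $ i * x $ i) \<in> borel_measurable (vec_borel n)"
      using i by (intro borel_measurable_times measurable_vec_index)
    have "?p ` {..<n} = {..<n}" using i j by simp
    then have "bij_betw ?p {..<n} {..<n}" by (simp add: bij_betw_def inj_on_transpose)
    then have "(\<integral>x. x $ i * x $ i \<partial>\<mu>) = (\<integral>x. (?Q *\<^sub>v x) $ i * (?Q *\<^sub>v x) $ i \<partial>\<mu>)"
      by (intro integral_orthogonal[OF _ m, symmetric] signed_perm_mat_orthogonal) auto
    also have "\<dots> = (\<integral>x. x $ j * x $ j \<partial>\<mu>)"
      using i j
      by (intro Bochner_Integration.integral_cong)
        (auto simp: rot_space unit_sphere_def signed_perm_mat_mult_vec)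
    finally show ?thesis .
  qed
  interpret prob_space \<mu> by (rule rot_prob)
  have "(1::real) = (\<integral>x. 1 \<partial>\<mu>)" by (simp add: prob_space)
  also have "\<dots> = (\<integral>x. (\<Sum>i<n. x $ i * x $ i) \<partial>\<mu>)"
  proof (rule Bochner_Integration.integral_cong[OF refl])
    fix x assume "x \<in> space \<mu>"
    then have "x \<in> carrier_vec n" "(eucl_norm x)\<^sup>2 = 1" by (auto simp: rot_space unit_sphere_def)
    then show "1 = (\<Sum>i<n. x $ i * x $ i)"
      by (simp add: eucl_norm_sq scalar_prod_self_eq_sum flip: power2_eq_square)
  qed
  also have "\<dots> = (\<Sum>i<n. \<integral>x. x $ i * x $ i \<partial>\<mu>)"
    by (intro Bochner_Integration.integral_sum integrable_coord_mult) auto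
  also have "\<dots> = real n * (\<integral>x. x $ j * x $ j \<partial>\<mu>)" using eq by simp
  finally show ?thesis using True j by (simp add: field_simps)
qed

text \<open>Expand |Bx|^2 as a quadratic form in the coordinates: the mixed terms integrate to 0,
  and what remains is the squared Hilbert-Schmidt norm of \<open>B\<close> divided by n.\<close>

lemma integral_norm_mult_mat_vec:
  assumes B: "B \<in> carrier_mat r n"
  shows "(\<integral>x. (eucl_norm (B *\<^sub>v x))\<^sup>2 \<partial>\<mu>) = (\<Sum>k<n. (eucl_norm (col B k))\<^sup>2) / real n"
proof -
  have "(\<integral>x. (eucl_norm (B *\<^sub>v x))\<^sup>2 \<partial>\<mu>)
    = (\<integral>x. (\<Sum>a<r. \<Sum>j<n. \<Sum>k<n. (B $$ (a, j) * B $$ (a, k)) * (x $ j * x $ k)) \<partial>\<mu>)"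
  proof (rule Bochner_Integration.integral_cong[OF refl])
    fix x assume "x \<in> space \<mu>"
    then have x: "x \<in> carrier_vec n" by (simp add: rot_space unit_sphere_def)
    then have "(eucl_norm (B *\<^sub>v x))\<^sup>2 = (\<Sum>a<r. ((B *\<^sub>v x) $ a)\<^sup>2)"
      unfolding eucl_norm_sq using B x by (intro scalar_prod_self_eq_sum) simp
    also have "\<dots> = (\<Sum>a<r. \<Sum>j<n. \<Sum>k<n. (B $$ (a, j) * B $$ (a, k)) * (x $ j * x $ k))"
      by (intro sum.cong refl)
        (simp add: mult_mat_vec_index_sum[OF B x] power2_eq_square sum_product ac_simps del: index_mult_mat_vec)
    finally show "(eucl_norm (B *\<^sub>v x))\<^sup>2 = \<dots>" .
  qed
  also have "\<dots> = (\<Sum>a<r. \<Sum>j<n. \<Sum>k<n. (B $$ (a, j) * B $$ (a, k)) * (\<integral>x. x $ j * x $ k \<partial>\<mu>))"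
    \<comment> \<open>Each round moves the integral inside one of the three sums; the integrability
      goals reduce to \<open>integrable_coord_mult\<close>.\<close>
    by (subst Bochner_Integration.integral_sum; (intro Bochner_Integration.integrable_sum
      integrable_mult_right integrable_coord_mult sum.cong refl)?; simp?)+
  also have "\<dots> = (\<Sum>a<r. \<Sum>j<n. (B $$ (a, j))\<^sup>2 / real n)"
    by (intro sum.cong refl) (simp add: integral_coord_mult if_distrib power2_eq_square cong: if_cong)
  also have "\<dots> = (\<Sum>j<n. \<Sum>a<r. (B $$ (a, j))\<^sup>2 / real n)" by (rule sum.swap)
  also have "\<dots> = (\<Sum>k<n. (eucl_norm (col B k))\<^sup>2 / real n)"
  proof (rule sum.cong[OF refl])
    fix k assume "k \<in> {..<n}"
    then have "(eucl_norm (col B k))\<^sup>2 = (\<Sum>a<r. (B $$ (a, k))\<^sup>2)"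
      using B by (simp add: eucl_norm_sq scalar_prod_self_eq_sum[of _ r])
    then show "(\<Sum>a<r. (B $$ (a, k))\<^sup>2 / real n) = (eucl_norm (col B k))\<^sup>2 / real n"
      by (simp add: sum_divide_distrib)
  qed
  finally show ?thesis by (simp add: sum_divide_distrib)
qed

text \<open>Substituting Qx for x leaves the integral unchanged and replaces T by TQ. The columns of
  TQ are the images under T of the columns of Q, so the mean square can be read off in any
  orthonormal basis.\<close>

lemma M_const_ellipsoid:
  assumes T: "T \<in> carrier_mat n n" and Q: "Q \<in> orthogonal_group n"
  shows "(M_const \<mu> {x \<in> carrier_vec n. T *\<^sub>v x \<in> unit_ball n})\<^sup>2
    = (\<Sum>k<n. (eucl_norm (col (T * Q) k))\<^sup>2) / real n"
proof -
  note q = orthogonal_groupD[OF Q]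
  have "(\<integral>x. (norm_of_body {x \<in> carrier_vec n. T *\<^sub>v x \<in> unit_ball n} x)\<^sup>2 \<partial>\<mu>)
    = (\<integral>x. (eucl_norm (T *\<^sub>v x))\<^sup>2 \<partial>\<mu>)"
    by (intro Bochner_Integration.integral_cong)
      (auto simp: rot_space unit_sphere_def norm_of_body_ellipsoid[OF T])
  also have "\<dots> = (\<integral>x. (eucl_norm (T *\<^sub>v (Q *\<^sub>v x)))\<^sup>2 \<partial>\<mu>)"
  proof (rule integral_orthogonal[OF Q, symmetric])
    show "(\<lambda>x. (eucl_norm (T *\<^sub>v x))\<^sup>2) \<in> borel_measurable (vec_borel n)"
      unfolding eucl_norm_sq by (intro measurable_scalar_prod[where n = n] measurable_mult_mat_vec T)
  qed
  also have "\<dots> = (\<integral>x. (eucl_norm ((T * Q) *\<^sub>v x))\<^sup>2 \<partial>\<mu>)"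
    by (intro Bochner_Integration.integral_cong)
      (auto simp: rot_space unit_sphere_def assoc_mult_mat_vec[OF T q(1)])
  also have "\<dots> = (\<Sum>k<n. (eucl_norm (col (T * Q) k))\<^sup>2) / real n"
    using T q(1) by (intro integral_norm_mult_mat_vec[of _ n]) simp
  finally show ?thesis by (simp add: M_const_def sum_nonneg)
qed

end

section \<open>Selecting the indices and bounding the operator on their span\<close>

text \<open>Start from the whole set and repeatedly discard an index with the largest term, which
  never raises the mean. Comparing means in multiplied-out form also covers empty sets.\<close>

lemma exists_subset_sum_le_average:
  fixes a :: "'a \<Rightarrow> real"
  assumes "finite A" "m \<le> card A"
  shows "\<exists>\<sigma>\<subseteq>A. card \<sigma> = m \<and> real (card A) * sum a \<sigma> \<le> real m * sum a A"
  using assms(2)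
proof (induction m rule: inc_induct)
  case base
  show ?case by (rule exI[of _ A]) simp
next
  case (step k)
  then obtain \<sigma> where \<sigma>: "\<sigma> \<subseteq> A" "card \<sigma> = Suc k"
    and le: "real (card A) * sum a \<sigma> \<le> real (Suc k) * sum a A" by blast
  have fin: "finite \<sigma>" using \<sigma>(1) assms(1) finite_subset by blast
  have "\<sigma> \<noteq> {}" using \<sigma>(2) by auto
  then obtain i where i: "i \<in> \<sigma>" "\<And>j. j \<in> \<sigma> \<Longrightarrow> a j \<le> a i"
    using fin obtains_MAX[of \<sigma> a] Max_ge[of "a ` \<sigma>"] by (metis finite_imageI imageI)
  have "sum a \<sigma> \<le> real (Suc k) * a i"
    using sum_bounded_above[of \<sigma> a "a i"] i(2) \<sigma>(2) by simp
  \<comment> \<open>With S the sum over \<sigma>, the discarded term is at least S / (k + 1), so at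
    most k S / (k + 1) remains; denominators are cleared.\<close>
  then have "real (Suc k) * (sum a \<sigma> - a i) \<le> real k * sum a \<sigma>" by (simp add: algebra_simps)
  then have "real (Suc k) * sum a (\<sigma> - {i}) \<le> real k * sum a \<sigma>"
    using fin i(1) by (simp add: sum_diff1)
  then have "real (card A) * (real (Suc k) * sum a (\<sigma> - {i})) \<le> real (card A) * (real k * sum a \<sigma>)"
    by (rule mult_left_mono) simp
  also have "\<dots> = real k * (real (card A) * sum a \<sigma>)" by simp
  also have "\<dots> \<le> real k * (real (Suc k) * sum a A)" by (rule mult_left_mono[OF le]) simp
  finally have "real (Suc k) * (real (card A) * sum a (\<sigma> - {i})) \<le> real (Suc k) * (real k * sum a A)"
    by (simp add: algebra_simps)
  then have "real (card A) * sum a (\<sigma> - {i}) \<le> real k * sum a A"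
    by (rule mult_left_le_imp_le) simp
  then show ?case using \<sigma> i(1) fin by (intro exI[of _ "\<sigma> - {i}"]) auto
qed

text \<open>Cauchy-Schwarz in each row. Since \<open>y\<close> is supported on \<open>I\<close>,
  only the columns indexed by \<open>I\<close> enter, and summing over the rows turns their entries
  into column norms.\<close>

lemma eucl_norm_mult_mat_vec_le:
  assumes B: "B \<in> carrier_mat r n" and y: "y \<in> carrier_vec n" and I: "I \<subseteq> {..<n}"
    and supp: "\<And>k. k < n \<Longrightarrow> k \<notin> I \<Longrightarrow> y $ k = 0"
  shows "(eucl_norm (B *\<^sub>v y))\<^sup>2 \<le> (\<Sum>k\<in>I. (eucl_norm (col B k))\<^sup>2) * (eucl_norm y)\<^sup>2"
proof -
  have fin: "finite I" using I finite_subset by blast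
  have ny: "(\<Sum>k\<in>I. (y $ k)\<^sup>2) = (eucl_norm y)\<^sup>2"
    unfolding eucl_norm_sq scalar_prod_self_eq_sum[OF y]
    by (rule sum.mono_neutral_left) (use I supp in auto)
  have "(eucl_norm (B *\<^sub>v y))\<^sup>2 = (\<Sum>a<r. ((B *\<^sub>v y) $ a)\<^sup>2)"
    unfolding eucl_norm_sq using B y by (intro scalar_prod_self_eq_sum) simp
  also have "\<dots> = (\<Sum>a<r. (\<Sum>k\<in>I. B $$ (a, k) * y $ k)\<^sup>2)"
  proof (intro sum.cong refl)
    fix a assume "a \<in> {..<r}"
    then have "(B *\<^sub>v y) $ a = (\<Sum>k<n. B $$ (a, k) * y $ k)"
      by (intro mult_mat_vec_index_sum[OF B y]) simp
    also have "\<dots> = (\<Sum>k\<in>I. B $$ (a, k) * y $ k)"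
      by (rule sum.mono_neutral_right) (use I supp in auto)
    finally show "((B *\<^sub>v y) $ a)\<^sup>2 = (\<Sum>k\<in>I. B $$ (a, k) * y $ k)\<^sup>2" by simp
  qed
  also have "\<dots> \<le> (\<Sum>a<r. (\<Sum>k\<in>I. (B $$ (a, k))\<^sup>2) * (\<Sum>k\<in>I. (y $ k)\<^sup>2))"
    by (intro sum_mono Cauchy_Schwarz_ineq_sum)
  also have "\<dots> = (\<Sum>k\<in>I. \<Sum>a<r. (B $$ (a, k))\<^sup>2) * (eucl_norm y)\<^sup>2"
    unfolding ny sum_distrib_right[symmetric] by (subst sum.swap) simp
  also have "(\<Sum>k\<in>I. \<Sum>a<r. (B $$ (a, k))\<^sup>2) = (\<Sum>k\<in>I. (eucl_norm (col B k))\<^sup>2)"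
  proof (rule sum.cong[OF refl])
    fix k assume "k \<in> I"
    then show "(\<Sum>a<r. (B $$ (a, k))\<^sup>2) = (eucl_norm (col B k))\<^sup>2"
      using B I by (auto simp: eucl_norm_sq scalar_prod_self_eq_sum[of _ r] subset_iff)
  qed
  finally show ?thesis .
qed

section \<open>Passage to the given basis and conclusion\<close>

text \<open>The entries of the transpose times the matrix are the inner products of the basis
  vectors. The shift by \<open>Suc\<close> reconciles basis indices 1..n with column indices
  0..n-1.\<close>

lemma mat_of_cols_orthonormal_basis:
  assumes e: "orthonormal_basis n e"
  shows "mat_of_cols n (map (\<lambda>k. e (Suc k)) [0..<n]) \<in> orthogonal_group n"
proof -
  let ?Q = "mat_of_cols n (map (\<lambda>k. e (Suc k)) [0..<n])"
  have c: "?Q \<in> carrier_mat n n" by (rule mat_of_cols_carrier(1)[of n "map _ [0..<n]", simplified])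
  have "transpose_mat ?Q * ?Q = 1\<^sub>m n"
    by (rule eq_matI) (use e c in \<open>auto simp: orthonormal_basis_def\<close>)
  then show ?thesis using c by (simp add: orthogonal_group_def)
qed

theorem theorem2p4:
  shows "\<exists>c > (0::real). \<exists>c' > (0::real).
    \<forall>n::nat. \<forall>\<mu> E e. \<forall>m::nat.
      n \<ge> 1 \<longrightarrow> rotation_invariant_prob n \<mu> \<longrightarrow> ellipsoid n E \<longrightarrow> orthonormal_basis n e \<longrightarrow>
      m \<ge> 1 \<longrightarrow> real m \<le> c * sqrt (real n) \<longrightarrow>
      (\<exists>\<sigma>. \<sigma> \<subseteq> {1..n} \<and> card \<sigma> = m \<and>
        (\<lambda>x. (c' / (sqrt (real m) * M_const \<mu> E)) \<cdot>\<^sub>v x) ` coord_ball n e \<sigma>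
          \<subseteq> E \<inter> coord_subspace n e \<sigma>)"
proof (rule exI[of _ 1], rule conjI, simp, rule exI[of _ 1], rule conjI, simp, intro allI impI)
  fix n \<mu> E e m
  assume n: "n \<ge> 1" and rot: "rotation_invariant_prob n \<mu>" and "ellipsoid n E"
    and e: "orthonormal_basis n e" and "m \<ge> 1" and m: "real m \<le> 1 * sqrt (real n)"
  then obtain T where T: "T \<in> carrier_mat n n"
    and E: "E = {x \<in> carrier_vec n. T *\<^sub>v x \<in> unit_ball n}" by (auto simp: ellipsoid_def)
  define Q where "Q = mat_of_cols n (map (\<lambda>k. e (Suc k)) [0..<n])"
  have Q: "Q \<in> orthogonal_group n" unfolding Q_def by (rule mat_of_cols_orthonormal_basis[OF e])
  note q = orthogonal_groupD[OF Q]
  have TQ: "T * Q \<in> carrier_mat n n" using T q(1) by simp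
  let ?a = "\<lambda>k. (eucl_norm (col (T * Q) k))\<^sup>2"
  let ?M = "M_const \<mu> E"
  have M: "?M\<^sup>2 = (\<Sum>k<n. ?a k) / real n" unfolding E by (rule M_const_ellipsoid[OF rot T Q])
  \<comment> \<open>The bound on m enters through m <= sqrt n <= n, which makes room for m
    indices.\<close>
  have "sqrt (real n) \<le> real n" using n by (intro real_le_lsqrt) (auto simp: power2_eq_square)
  then obtain I where I: "I \<subseteq> {..<n}" "card I = m" and "real n * sum ?a I \<le> real m * (\<Sum>k<n. ?a k)"
    using exists_subset_sum_le_average[of "{..<n}" m ?a] m by auto
  then have sumI: "sum ?a I \<le> real m * ?M\<^sup>2" unfolding M using n by (simp add: field_simps)
  let ?r = "1 / (sqrt (real m) * ?M)"
  \<comment> \<open>The witness for \<sigma> is \<open>Suc\<close> followed by the image of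
    \<open>I\<close>, that is, \<open>I\<close> moved from column indices back to basis
    indices.\<close>
  have "?r \<cdot>\<^sub>v x \<in> E \<inter> coord_subspace n e (Suc ` I)" if "x \<in> coord_ball n e (Suc ` I)" for x
  proof -
    have x: "x \<in> carrier_vec n" "eucl_norm x \<le> 1"
      and sub: "\<And>j. j \<in> {1..n} \<Longrightarrow> j \<notin> Suc ` I \<Longrightarrow> scalar_prod x (e j) = 0"
      using that by (auto simp: coord_ball_def unit_ball_def coord_subspace_def)
    \<comment> \<open>\<open>y\<close> lists the coordinates of x in the basis e. It has the same
      norm as x and vanishes off \<open>I\<close>, and (TQ)y = Tx.\<close>
    define y where "y = transpose_mat Q *\<^sub>v x"
    have y: "y \<in> carrier_vec n" using q x by (simp add: y_def)
    have Qy: "Q *\<^sub>v y = x"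
      using q x assoc_mult_mat_vec[of Q n n "transpose_mat Q" n x] by (simp add: y_def)
    have "eucl_norm y = eucl_norm x"
      using orthogonal_scalar_prod[OF Q y] by (simp add: eucl_norm_def Qy)
    then have ny: "(eucl_norm y)\<^sup>2 \<le> 1" using x eucl_norm_nonneg[of x] by (simp add: power_le_one)
    have "y $ k = 0" if k: "k < n" "k \<notin> I" for k
    proof -
      have ek: "e (Suc k) \<in> carrier_vec n" using e k by (simp add: orthonormal_basis_def)
      have "col Q k = e (Suc k)" using k ek by (simp add: Q_def)
      then have "y $ k = scalar_prod (e (Suc k)) x" using k q by (simp add: y_def)
      then show ?thesis using sub[of "Suc k"] k comm_scalar_prod[OF ek x(1)] by auto
    qed
    then have "(eucl_norm ((T * Q) *\<^sub>v y))\<^sup>2 \<le> sum ?a I * (eucl_norm y)\<^sup>2"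
      by (intro eucl_norm_mult_mat_vec_le[OF TQ y I(1)])
    also have "\<dots> \<le> sum ?a I * 1" by (rule mult_left_mono[OF ny]) (simp add: sum_nonneg)
    finally have Tx: "(eucl_norm (T *\<^sub>v x))\<^sup>2 \<le> real m * ?M\<^sup>2"
      using sumI assoc_mult_mat_vec[OF T q(1) y] Qy by simp
    have "(eucl_norm (T *\<^sub>v (?r \<cdot>\<^sub>v x)))\<^sup>2 = ?r\<^sup>2 * (eucl_norm (T *\<^sub>v x))\<^sup>2"
      by (simp only: mult_mat_vec[OF T x(1)] eucl_norm_smult power_mult_distrib power2_abs)
    also have "\<dots> \<le> ?r\<^sup>2 * (real m * ?M\<^sup>2)" by (rule mult_left_mono[OF Tx]) simp
    \<comment> \<open>The product is 1 when the denominator of \<open>?r\<close> is nonzero;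
      otherwise \<open>1 / 0 = 0\<close> makes it 0, hence an inequality.\<close>
    also have "\<dots> \<le> 1" by (simp add: power_divide power_mult_distrib)
    finally have "eucl_norm (T *\<^sub>v (?r \<cdot>\<^sub>v x)) \<le> 1"
      using power2_le_imp_le[of _ "1::real"] by simp
    then have "?r \<cdot>\<^sub>v x \<in> E" using T x(1) by (simp add: E unit_ball_def)
    moreover have "?r \<cdot>\<^sub>v x \<in> coord_subspace n e (Suc ` I)"
      using x(1) sub e by (auto simp: coord_subspace_def orthonormal_basis_def)
    ultimately show ?thesis by blast
  qed
  moreover have "Suc ` I \<subseteq> {1..n}" using I(1) by auto
  moreover have "card (Suc ` I) = m" using I(2) by (simp add: card_image)
  ultimately show "\<exists>\<sigma>. \<sigma> \<subseteq> {1..n} \<and> card \<sigma> = m \<and>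
      (\<lambda>x. ?r \<cdot>\<^sub>v x) ` coord_ball n e \<sigma> \<subseteq> E \<inter> coord_subspace n e \<sigma>"
    by (intro exI[of _ "Suc ` I"]) blast
qed

end
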